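(* Let $s$ be a positive integer and let $M\subset \mathbb{C}[x,y]$ be an L-module of order $s$. Then there exists a linear map $L\colon \mathbb{C}[x]^s\to \mathbb{C}[x]$ such that for every $F\in M$ we have $$[F]_n = L([F]_{n-s},\ldots ,[F]_{n-1})\qquad ( * )$$ for every $n\ge s$. More precisely, there are complex numbers $a_{i,j}$ $(i=1,\ldots ,s,\ j=1,2,\ldots)$ such that $( * )$ holds for every $F\in M$ and every $n\ge s$, where $$L(f_1,\ldots ,f_s)=\sum_{i=1}^s\sum_{j=1}^\infty a_{i,j} f_i^{(j)}$$ for every $f_1,\ldots ,f_s\in \mathbb{C}[x]$ (for each $(f_1,\ldots,f_s)$ only finitely many terms of the sum are nonzero).
   Context: A submodule (or module) of $\mathbb{C}[x,y]$ is a translation invariant linear subspace of $\mathbb{C}[x,y]$; equivalently, a linear subspace closed under the partial derivatives $\partial/\partial x$ and $\partial/\partial y$. Every $F\in \mathbb{C}[x,y]$ can be written uniquely as $F(x,y)=\sum_{n=0}^\infty f_n(x)\frac{y^n}{n!}$ with $f_n\in \mathbb{C}[x]$ and $f_n=0$ for all large $n$; the coordinate polynomials of $F$ are $[F]_n=f_n$. For a positive integer $s$, a set $M\subset\mathbb{C}[x,y]$ is an L-module of order $s$ if $M$ is a module and, whenever $F\in M$ and $[F]_n=0$ for every $n<s$, then $F=0$. $f^{(j)}$ denotes the $j$-th derivative. *)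

theory Defs
  imports Complex_Main "HOL-Computational_Algebra.Polynomial" "HOL-Library.Function_Algebras"
begin

(* C[x,y] is represented as C[x][y]: the inner variable is x and the outer variable is y. *)

type_synonym bipoly = "complex poly poly"

definition scale2 :: "complex \<Rightarrow> bipoly \<Rightarrow> bipoly" where
  "scale2 c F = smult [:c:] F"

(* F(x + a, y + b) *)
definition translate :: "complex \<Rightarrow> complex \<Rightarrow> bipoly \<Rightarrow> bipoly" where
  "translate a b F = pcompose (map_poly (\<lambda>f. pcompose f [:a, 1:]) F) [:[:b:], 1:]"

lemma poly_translate:
  "poly (poly (translate a b F) [:y:]) x = poly (poly F [:y + b:]) (x + a)"
proof -
  have map_pCons: "map_poly (\<lambda>f. pcompose f [:a, 1:]) (pCons g G) =
      pCons (pcompose g [:a, 1:]) (map_poly (\<lambda>f. pcompose f [:a, 1:]) G)"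
    for g :: "complex poly" and G
    by (rule poly_eqI) (simp add: coeff_map_poly coeff_pCons split: nat.split)
  have "poly (poly (map_poly (\<lambda>f. pcompose f [:a, 1:]) F) [:z:]) x = poly (poly F [:z:]) (x + a)"
    for z
    by (induction F) (simp_all add: map_pCons poly_pcompose add.commute)
  then show ?thesis
    by (simp add: translate_def poly_pcompose add.commute)
qed

definition poly_module :: "bipoly set \<Rightarrow> bool" where
  "poly_module M \<longleftrightarrow> module.subspace scale2 M \<and> (\<forall>F\<in>M. \<forall>a b. translate a b F \<in> M)"

lemma vector_space_scale2: "vector_space scale2"
  by standard (simp_all add: scale2_def smult_add_right mult.commute flip: smult_add_left one_pCons)

(* The coefficient of y^n/n! (not of y^n), a polynomial in x. *)
definition coord :: "bipoly \<Rightarrow> nat \<Rightarrow> complex poly" where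
  "coord F n = smult (fact n) (coeff F n)"

lemma coord_expansion: "F = (\<Sum>n\<le>degree F. monom (smult (1 / fact n) (coord F n)) n)"
  by (simp add: coord_def poly_as_sum_of_monoms)

definition L_module :: "nat \<Rightarrow> bipoly set \<Rightarrow> bool" where
  "L_module s M \<longleftrightarrow> poly_module M \<and> (\<forall>F\<in>M. (\<forall>n<s. coord F n = 0) \<longrightarrow> F = 0)"

(* A tuple (f_1, ..., f_s) in C[x]^s is represented by a function on nat of which only the values
   at 1, ..., s matter. So the linear maps from C[x]^s to C[x] are the linear maps on all such
   functions that depend only on these s entries. *)
definition scale_tuple :: "complex \<Rightarrow> (nat \<Rightarrow> complex poly) \<Rightarrow> (nat \<Rightarrow> complex poly)" where
  "scale_tuple c f = (\<lambda>i. smult c (f i))"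

definition linear_on_tuples :: "nat \<Rightarrow> ((nat \<Rightarrow> complex poly) \<Rightarrow> complex poly) \<Rightarrow> bool" where
  "linear_on_tuples s L \<longleftrightarrow>
     Vector_Spaces.linear scale_tuple smult L \<and>
     (\<forall>f g. (\<forall>i\<in>{1..s}. f i = g i) \<longrightarrow> L f = L g)"

lemma vector_space_scale_tuple: "vector_space scale_tuple"
  by standard (simp_all add: scale_tuple_def fun_eq_iff smult_add_right smult_add_left)

definition nonzero_terms ::
    "(nat \<Rightarrow> nat \<Rightarrow> complex) \<Rightarrow> (nat \<Rightarrow> complex poly) \<Rightarrow> nat \<Rightarrow> nat set" where
  "nonzero_terms a f i = {j. 1 \<le> j \<and> smult (a i j) ((pderiv ^^ j) (f i)) \<noteq> 0}"

(* The inner series over j >= 1 is the finite sum of its nonzero terms. *)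
definition diff_op :: "nat \<Rightarrow> (nat \<Rightarrow> nat \<Rightarrow> complex) \<Rightarrow> (nat \<Rightarrow> complex poly) \<Rightarrow> complex poly" where
  "diff_op s a f =
     (\<Sum>i = 1..s. \<Sum>j \<in> nonzero_terms a f i. smult (a i j) ((pderiv ^^ j) (f i)))"

end

theory Submission
  imports Defs
begin

text \<open>
  The derivative \<open>\<partial>/\<partial>y\<close> shifts the sequence of coordinates, and \<open>\<partial>/\<partial>x\<close> differentiates each coordinate.
  Both preserve \<open>M\<close> (\<open>poly_module_pderiv_x\<close>, \<open>poly_module_pderiv_y\<close>): a translate \<open>F (x + a, y + b)\<close> is
  polynomial in \<open>a\<close> and in \<open>b\<close>, and a polynomial curve in a linear subspace has its coefficients there.

  An element \<open>F\<close> of \<open>M\<close> is determined by its first \<open>s\<close> coordinates, so \<open>[F]\<^sub>s\<close> is a linear function of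
  them, and this function commutes with \<open>d/dx\<close>. A linear map of polynomials commuting with \<open>d/dx\<close> is
  known once the constant term of its value is known, since the \<open>k\<close>-th coefficient is, up to
  \<open>k!\<close>, the constant term of the value at the \<open>k\<close>-th derivative. So it is enough to treat the linear
  functional \<open>F \<mapsto> [F]\<^sub>s (0)\<close>. By \<open>L_module_next_coord_of_constants\<close> it vanishes on every \<open>F\<close> whose first
  \<open>s\<close> coordinates are constant, so it depends only on the derivatives of these coordinates and extends
  to a functional \<open>\<mu>\<close> on all tuples (\<open>linear_factors_through\<close>). Every such functional of the derivatives
  is the constant term of a differential operator without terms of order \<open>0\<close>
  (\<open>functional_as_constant_term_of_diff_op\<close>). This operator is \<open>L\<close>. It gives \<open>[F]\<^sub>s\<close>, and applying it
  to \<open>\<partial>\<^sup>m F/\<partial>y\<^sup>m\<close> gives \<open>[F]\<^sub>n\<close> for \<open>n = s + m\<close>.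
\<close>

interpretation bipoly_vs: vector_space scale2
  by (rule vector_space_scale2)

interpretation tuple_vs: vector_space scale_tuple
  by (rule vector_space_scale_tuple)

interpretation poly_vs: vector_space "smult :: complex \<Rightarrow> complex poly \<Rightarrow> complex poly"
  by standard (simp_all add: smult_add_right smult_add_left)

section \<open>Translation invariance gives invariance under the partial derivatives\<close>

text \<open>
  If \<open>P a = \<Sum>k\<le>N. a\<^sup>k v\<^sub>k\<close> lies in \<open>S\<close> for every scalar \<open>a\<close>, then the combination
  \<open>P (2 a) - 2\<^sup>N P a\<close> kills the leading term and multiplies every lower \<open>v\<^sub>k\<close> by the nonzero
  number \<open>2\<^sup>k - 2\<^sup>N\<close>. So the degree of the curve can be lowered inside \<open>S\<close>.
\<close>
lemma coefficients_in_subspace: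
  fixes scale :: "'a::field_char_0 \<Rightarrow> 'b::ab_group_add \<Rightarrow> 'b"
  assumes "vector_space scale" and sub: "module.subspace scale S"
    and "\<And>a. (\<Sum>k\<le>N. scale (a ^ k) (v k)) \<in> S" and "k \<le> N"
  shows "v k \<in> S"
proof -
  interpret vector_space scale by fact
  show ?thesis
    using assms(3,4)
  proof (induction N arbitrary: v k)
    case 0
    from "0.prems"(1)[of 1] "0.prems"(2) show ?case by simp
  next
    case (Suc N)
    define P where "P a = (\<Sum>k\<le>Suc N. scale (a ^ k) (v k))" for a
    define w where "w j = scale (2 ^ j - 2 ^ Suc N) (v j)" for j
    have P: "P a \<in> S" for a
      unfolding P_def by (rule Suc.prems)
    have low: "v j \<in> S" if "j \<le> N" for j
    proof -
      have "(\<Sum>j\<le>N. scale (a ^ j) (w j)) \<in> S" for a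
      proof -
        have "P (2 * a) - scale (2 ^ Suc N) (P a) = (\<Sum>j\<le>Suc N. scale (a ^ j) (w j))"
          unfolding P_def w_def scale_sum_right sum_subtractf[symmetric]
          by (rule sum.cong) (simp_all add: algebra_simps)
        also have "\<dots> = (\<Sum>j\<le>N. scale (a ^ j) (w j))"
          by (simp add: w_def)
        finally show ?thesis
          using P subspace_diff[OF sub] subspace_scale[OF sub] by metis
      qed
      then have "w j \<in> S"
        using that by (rule Suc.IH)
      moreover have "(2::'a) ^ j - 2 ^ Suc N \<noteq> 0"
      proof -
        have "(2::nat) ^ j \<noteq> 2 ^ Suc N"
          using that by (subst power_inject_exp) auto
        then have "(of_nat (2 ^ j) :: 'a) \<noteq> of_nat (2 ^ Suc N)"
          by (simp only: of_nat_eq_iff not_False_eq_True)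
        then show ?thesis by simp
      qed
      then have "v j = scale (inverse (2 ^ j - 2 ^ Suc N)) (w j)"
        by (simp add: w_def)
      ultimately show ?thesis
        using subspace_scale[OF sub] by metis
    qed
    show ?case
    proof (cases "k \<le> N")
      case True
      then show ?thesis by (rule low)
    next
      case False
      with Suc.prems(2) have "k = Suc N" by simp
      moreover have "v (Suc N) = P 1 - (\<Sum>j\<le>N. v j)"
        by (simp add: P_def)
      moreover have "(\<Sum>j\<le>N. v j) \<in> S"
        by (rule subspace_sum[OF sub]) (simp add: low)
      ultimately show ?thesis
        using P subspace_diff[OF sub] by metis
    qed
  qed
qed

text \<open>
  A curve in \<open>\<complex>[x,y]\<close> that depends polynomially on \<open>a\<close> is encoded as a polynomial over \<open>\<complex>[x,y]\<close>,
  evaluated at the constant \<open>a\<close>.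
\<close>
lemma bipoly_coefficient_in_subspace:
  fixes P :: "bipoly poly"
  assumes "module.subspace scale2 M" and "\<And>a. poly P [:[:a:]:] \<in> M"
  shows "coeff P k \<in> M"
proof (cases "k \<le> degree P")
  case True
  have const_power: "[:[:a:]:] ^ j = [:[:a ^ j:]:]" for a :: complex and j
    by (simp add: poly_const_pow)
  have "poly P [:[:a:]:] = (\<Sum>k\<le>degree P. scale2 (a ^ k) (coeff P k))" for a
    unfolding poly_altdef const_power
    by (rule sum.cong) (simp_all add: scale2_def)
  then show ?thesis
    using coefficients_in_subspace[OF vector_space_scale2 assms(1) _ True] assms(2) by simp
next
  case False
  then show ?thesis
    using bipoly_vs.subspace_0[OF assms(1)] by (simp add: coeff_eq_0)
qed

text \<open>
  The first-order part of the Taylor formula. As a polynomial in \<open>a\<close>, \<open>p (x + a)\<close> has the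
  derivative of \<open>p\<close> as its linear coefficient. No factorials occur, so this also applies to
  coefficient rings such as \<open>\<complex>[x]\<close> that are not fields.
\<close>
lemma shift_as_polynomial:
  fixes p :: "'a::idom poly"
  shows "\<exists>V. (\<forall>a. poly V [:a:] = pcompose p [:a, 1:]) \<and> coeff V 0 = p \<and> coeff V 1 = pderiv p"
proof (induction p)
  case 0
  show ?case by (intro exI[of _ 0]) simp
next
  case (pCons c p)
  then obtain V where V: "\<And>a. poly V [:a:] = pcompose p [:a, 1:]" "coeff V 0 = p"
    "coeff V 1 = pderiv p"
    by blast
  \<comment> \<open>Horner's rule: \<open>(c + x p) (x + a) = c + (x + a) p (x + a)\<close>.\<close>
  show ?case
    by (rule exI[of _ "[:[:c:]:] + [:[:0, 1:], 1:] * V"])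
      (use V in \<open>simp add: pcompose_pCons pderiv_pCons algebra_simps coeff_pCons\<close>)
qed

lemma map_poly_pCons_hom:
  assumes "h 0 = 0"
  shows "map_poly h (pCons a p) = pCons (h a) (map_poly h p)"
  by (rule poly_eqI) (simp add: coeff_map_poly coeff_pCons assms split: nat.split)

lemma coord_add: "coord (F + G) n = coord F n + coord G n"
  by (simp add: coord_def smult_add_right)

lemma coord_scale2: "coord (scale2 c F) n = smult c (coord F n)"
  by (simp add: coord_def scale2_def mult.commute)

lemma coord_pderiv: "coord (pderiv F) n = coord F (Suc n)"
  by (simp add: coord_def coeff_pderiv of_nat_poly mult.commute)

definition pderiv_x :: "bipoly \<Rightarrow> bipoly" where
  "pderiv_x F = map_poly pderiv F"

lemma coord_pderiv_x: "coord (pderiv_x F) n = pderiv (coord F n)"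
  by (simp add: coord_def pderiv_x_def coeff_map_poly pderiv_smult)

lemma translate_x_as_polynomial:
  "\<exists>W. (\<forall>a. poly W [:[:a:]:] = translate a 0 F) \<and> coeff W 1 = pderiv_x F"
proof -
  have "\<exists>W. (\<forall>a. poly W [:[:a:]:] = map_poly (\<lambda>f. pcompose f [:a, 1:]) F) \<and>
            coeff W 1 = pderiv_x F"
  proof (induction F)
    case 0
    show ?case by (intro exI[of _ 0]) (simp add: pderiv_x_def)
  next
    case (pCons f F)
    then obtain W where W: "\<And>a. poly W [:[:a:]:] = map_poly (\<lambda>f. pcompose f [:a, 1:]) F"
      "coeff W 1 = pderiv_x F"
      by blast
    obtain V where V: "\<And>a. poly V [:a:] = pcompose f [:a, 1:]" "coeff V 1 = pderiv f"
      using shift_as_polynomial[of f] by blast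
    have lift: "poly (map_poly (\<lambda>g. [:g:]) V) [:[:a:]:] = [:poly V [:a:]:]" for a
      by (induction V) (simp_all add: map_poly_pCons_hom)
    \<comment> \<open>The coefficient of \<open>y\<^sup>0\<close> is shifted by itself; the rest is multiplied by \<open>y\<close>, which an
        \<open>x\<close>-translation leaves alone.\<close>
    show ?case
      by (rule exI[of _ "map_poly (\<lambda>g. [:g:]) V + smult [:0, 1:] W"])
        (use W V in \<open>simp add: lift map_poly_pCons_hom pderiv_x_def coeff_map_poly\<close>)
  qed
  then show ?thesis
    by (simp add: translate_def)
qed

lemma poly_module_pderiv_x:
  assumes "poly_module M" and "F \<in> M"
  shows "pderiv_x F \<in> M"
proof -
  obtain W where "\<And>a. poly W [:[:a:]:] = translate a 0 F" "coeff W 1 = pderiv_x F"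
    using translate_x_as_polynomial by blast
  with assms show ?thesis
    using bipoly_coefficient_in_subspace[of M W 1] by (simp add: poly_module_def)
qed

lemma poly_module_pderiv_y:
  assumes "poly_module M" and "F \<in> M"
  shows "pderiv F \<in> M"
proof -
  obtain V where V: "\<And>b. poly V [:b:] = pcompose F [:b, 1:]" "coeff V 1 = pderiv F"
    using shift_as_polynomial[of F] by blast
  have "poly V [:[:b:]:] = translate 0 b F" for b
    by (simp add: V translate_def map_poly_idI)
  with assms V(2) show ?thesis
    using bipoly_coefficient_in_subspace[of M V 1] by (simp add: poly_module_def)
qed

section \<open>Elements whose first coordinates are constant\<close>

text \<open>
  The derivatives of \<open>q\<close> have all the degrees from \<open>0\<close> to \<open>degree q\<close>, so they span all the
  polynomials of degree at most \<open>degree q\<close>.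
\<close>
lemma pderiv_closed_contains_lower_degrees:
  fixes S :: "complex poly set"
  assumes sub: "module.subspace smult S" and closed: "\<And>p. p \<in> S \<Longrightarrow> pderiv p \<in> S"
    and "q \<in> S" "q \<noteq> 0" "degree p \<le> degree q"
  shows "p \<in> S"
  using assms(3-5)
proof (induction "degree q" arbitrary: p q rule: less_induct)
  case less
  define r where "r = p - smult (coeff p (degree q) / lead_coeff q) q"
  have coeff_r: "coeff r k = 0" if "k \<ge> degree q" for k
    using that less.prems(2,3) by (cases "k = degree q") (auto simp: r_def coeff_eq_0)
  have "r \<in> S"
  proof (cases "r = 0")
    case True
    then show ?thesis using poly_vs.subspace_0[OF sub] by simp
  next
    case False
    with coeff_r[of "degree r"] have "degree r < degree q"
      by (meson leading_coeff_neq_0 not_le)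
    then have "degree (pderiv q) < degree q" "degree r \<le> degree (pderiv q)" "pderiv q \<noteq> 0"
      by (auto simp: degree_pderiv pderiv_eq_0_iff)
    then show ?thesis
      using less.hyps[of "pderiv q" r] closed less.prems(1) by blast
  qed
  moreover have "p = r + smult (coeff p (degree q) / lead_coeff q) q"
    by (simp add: r_def)
  ultimately show ?case
    using poly_vs.subspace_add[OF sub] poly_vs.subspace_scale[OF sub] less.prems(1) by metis
qed

text \<open>
  This is why the operator needs no term of order \<open>0\<close>. If the first \<open>s\<close> coordinates of \<open>F\<close> are
  constant, then the \<open>x\<close>-derivative of \<open>F\<close> has vanishing first coordinates, so it is \<open>0\<close> and \<open>F\<close> is
  a polynomial in \<open>y\<close> alone. If its degree were at least \<open>s\<close>, then the \<open>y\<close>-derivatives of \<open>F\<close> would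
  span a space that contains \<open>y\<^sup>s\<close>, a nonzero element whose first \<open>s\<close> coordinates vanish.
\<close>
lemma L_module_next_coord_of_constants:
  assumes L: "L_module s M" and "F \<in> M" and const: "\<And>n. n < s \<Longrightarrow> pderiv (coord F n) = 0"
  shows "coord F s = 0"
proof (rule ccontr)
  assume ne: "coord F s \<noteq> 0"
  have M: "poly_module M" "module.subspace scale2 M"
    and inj: "\<And>G. G \<in> M \<Longrightarrow> (\<And>n. n < s \<Longrightarrow> coord G n = 0) \<Longrightarrow> G = 0"
    using L by (auto simp: L_module_def poly_module_def)
  \<comment> \<open>\<open>emb\<close> reads a one-variable polynomial as a polynomial in \<open>y\<close>.\<close>
  define emb :: "complex poly \<Rightarrow> bipoly" where "emb = map_poly (\<lambda>c. [:c:])"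
  have coeff_emb: "coeff (emb q) n = [:coeff q n:]" for q n
    by (simp add: emb_def coeff_map_poly)
  have emb_hom: "emb 0 = 0" "emb (p + q) = emb p + emb q" "emb (smult c p) = scale2 c (emb p)"
    "emb (pderiv p) = pderiv (emb p)" for p q c
    by (rule poly_eqI; simp add: coeff_emb scale2_def coeff_pderiv of_nat_poly)+
  define S where "S = {q. emb q \<in> M}"
  have S: "module.subspace smult S"
    unfolding S_def poly_vs.subspace_def
    using bipoly_vs.subspace_0[OF M(2)] bipoly_vs.subspace_add[OF M(2)]
      bipoly_vs.subspace_scale[OF M(2)]
    by (simp add: emb_hom)
  have closed: "pderiv q \<in> S" if "q \<in> S" for q
    using that poly_module_pderiv_y[OF M(1)] by (simp add: S_def emb_hom)
  have "pderiv_x F = 0"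
    using inj poly_module_pderiv_x[OF M(1)] const \<open>F \<in> M\<close> by (simp add: coord_pderiv_x)
  then have deriv_0: "pderiv (coord F n) = 0" for n
    using coord_pderiv_x[of F n] by (simp add: coord_def)
  have coeff_F: "coeff F n = [:coeff (coeff F n) 0:]" for n
  proof -
    have "pderiv (coeff F n) = 0"
      using deriv_0[of n] by (simp add: coord_def pderiv_smult)
    then obtain c where "coeff F n = [:c:]"
      using pderiv_iszero by blast
    then show ?thesis by simp
  qed
  define q where "q = map_poly (\<lambda>f. coeff f 0) F"
  have "emb q = F"
    by (rule poly_eqI) (simp add: coeff_emb q_def coeff_map_poly coeff_F[symmetric])
  then have "q \<in> S"
    using \<open>F \<in> M\<close> by (simp add: S_def)
  have "coeff q s \<noteq> 0"
    using ne coeff_emb[of q s] unfolding \<open>emb q = F\<close> coord_def by auto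
  then have "q \<noteq> 0" "s \<le> degree q"
    by (auto intro: le_degree)
  then have "monom 1 s \<in> S"
    using pderiv_closed_contains_lower_degrees[OF S _ \<open>q \<in> S\<close>, of "monom 1 s"] closed
    by (simp add: degree_monom_eq)
  then have "emb (monom 1 s) = 0"
    using inj[of "emb (monom 1 s)"] by (simp add: S_def coord_def coeff_emb)
  then show False
    using coeff_emb[of "monom 1 s" s] by simp
qed

section \<open>Linear functionals on tuples as differential operators\<close>

text \<open>
  On the image of \<open>V\<close> under \<open>T\<close> the value of \<open>\<mu>\<close> is forced, and the condition on the kernel makes it
  well defined. A linear map \<open>g\<close> into \<open>V\<close>, right inverse to \<open>T\<close> on this image, is defined on the whole
  target space, so \<open>\<nu> \<circ> g\<close> also takes care of the extension.
\<close>
lemma linear_factors_through: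
  assumes T: "Vector_Spaces.linear s1 s2 T" and nu: "Vector_Spaces.linear s1 s3 \<nu>"
    and V: "module.subspace s1 V" and ker: "\<And>v. v \<in> V \<Longrightarrow> T v = 0 \<Longrightarrow> \<nu> v = 0"
  shows "\<exists>\<mu>. Vector_Spaces.linear s2 s3 \<mu> \<and> (\<forall>v\<in>V. \<mu> (T v) = \<nu> v)"
proof -
  interpret T: Vector_Spaces.linear s1 s2 T by fact
  interpret nu: Vector_Spaces.linear s1 s3 \<nu> by fact
  interpret pair: vector_space_pair s1 s2 ..
  obtain g where g: "range g \<subseteq> V" "Vector_Spaces.linear s2 s1 g" "\<forall>w\<in>T ` V. T (g w) = w"
    using pair.linear_exists_right_inverse_on[OF T V] by blast
  have "\<nu> (g (T v)) = \<nu> v" if "v \<in> V" for v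
  proof -
    have "g (T v) - v \<in> V"
      using g(1) that T.vs1.subspace_diff[OF V] by blast
    moreover have "T (g (T v) - v) = 0"
      using g(3) that by (simp add: T.diff)
    ultimately show ?thesis
      using ker nu.diff by fastforce
  qed
  with Vector_Spaces.linear_compose[OF g(2) nu] show ?thesis
    by (intro exI[of _ "\<nu> \<circ> g"]) simp
qed

definition single :: "nat \<Rightarrow> complex poly \<Rightarrow> nat \<Rightarrow> complex poly" where
  "single i p = (\<lambda>m. if m = i then p else 0)"

definition restrict_tuple :: "nat \<Rightarrow> (nat \<Rightarrow> complex poly) \<Rightarrow> nat \<Rightarrow> complex poly" where
  "restrict_tuple s h = (\<lambda>i. if i \<in> {1..s} then h i else 0)"

lemma single_hom:
  "single i 0 = 0" "single i (p + q) = single i p + single i q"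
  "single i (smult c p) = scale_tuple c (single i p)"
  by (simp_all add: single_def scale_tuple_def fun_eq_iff)

lemma restrict_tuple_eq_sum: "restrict_tuple s h = (\<Sum>i=1..s. single i (h i))"
proof
  fix m
  have "(\<Sum>i\<in>I. single i (h i)) m = (\<Sum>i\<in>I. single i (h i) m)" for I :: "nat set"
    by (induction I rule: infinite_finite_induct) simp_all
  then show "restrict_tuple s h m = (\<Sum>i=1..s. single i (h i)) m"
    by (simp add: restrict_tuple_def single_def)
qed

lemma higher_pderiv_eq_0: "degree p < j \<Longrightarrow> (pderiv ^^ j) p = 0" for p :: "complex poly"
  by (intro poly_eqI) (simp add: coeff_higher_pderiv coeff_eq_0)

lemma nonzero_terms_subset: "degree (f i) \<le> N \<Longrightarrow> nonzero_terms a f i \<subseteq> {1..N}"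
  using higher_pderiv_eq_0[of "f i"] by (fastforce simp: nonzero_terms_def not_less[symmetric])

lemma finite_nonzero_terms: "finite (nonzero_terms a f i)"
  using nonzero_terms_subset[OF order_refl] by (rule finite_subset) simp

lemma degree_le_sum_degree:
  fixes f :: "nat \<Rightarrow> complex poly"
  shows "i \<in> {1..s} \<Longrightarrow> degree (f i) \<le> (\<Sum>i=1..s. degree (f i))"
  by (rule member_le_sum) auto

text \<open>
  The summation ranges of \<open>diff_op\<close> depend on the tuple. Algebra with several tuples is possible only
  after the inner sums have been extended to one common range.
\<close>
lemma diff_op_eq_sum:
  assumes "\<forall>i\<in>{1..s}. degree (f i) \<le> N"
  shows "diff_op s a f = (\<Sum>i=1..s. \<Sum>j=1..N. smult (a i j) ((pderiv ^^ j) (f i)))"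
  unfolding diff_op_def
  by (intro sum.cong[OF refl] sum.mono_neutral_left)
    (use assms nonzero_terms_subset[of f _ N a] in \<open>auto simp: nonzero_terms_def\<close>)

lemma linear_on_tuples_diff_op: "linear_on_tuples s (diff_op s a)"
proof -
  have "diff_op s a (f + g) = diff_op s a f + diff_op s a g" for f g
  proof -
    define N where "N = (\<Sum>i=1..s. degree (f i)) + (\<Sum>i=1..s. degree (g i))"
    have N: "\<forall>i\<in>{1..s}. degree (f i) \<le> N" "\<forall>i\<in>{1..s}. degree (g i) \<le> N"
      unfolding N_def using degree_le_sum_degree trans_le_add1 trans_le_add2 by blast+
    then have "\<forall>i\<in>{1..s}. degree ((f + g) i) \<le> N"
      by (simp add: degree_add_le)
    note N = N this
    show ?thesis
      unfolding diff_op_eq_sum[of s f, OF N(1)] diff_op_eq_sum[of s g, OF N(2)]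
        diff_op_eq_sum[of s "f + g", OF N(3)]
      by (simp add: higher_pderiv_add smult_add_right sum.distrib)
  qed
  moreover have "diff_op s a (scale_tuple c f) = smult c (diff_op s a f)" for c f
  proof -
    define N where "N = (\<Sum>i=1..s. degree (f i))"
    have N: "\<forall>i\<in>{1..s}. degree (f i) \<le> N" "\<forall>i\<in>{1..s}. degree (scale_tuple c f i) \<le> N"
      using degree_le_sum_degree[of _ s f] by (auto simp: N_def scale_tuple_def)
    show ?thesis
      unfolding diff_op_eq_sum[of s f, OF N(1)] diff_op_eq_sum[of s "scale_tuple c f", OF N(2)]
      by (simp add: scale_tuple_def higher_pderiv_smult poly_vs.scale_sum_right mult.commute)
  qed
  moreover have "diff_op s a f = diff_op s a g" if "\<forall>i\<in>{1..s}. f i = g i" for f g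
    using that by (auto simp: diff_op_def nonzero_terms_def intro!: sum.cong)
  ultimately show ?thesis
    unfolding linear_on_tuples_def Vector_Spaces.linear_iff
    using tuple_vs.vector_space_axioms poly_vs.vector_space_axioms by blast
qed

lemma coeff_0_higher_pderiv: "coeff ((pderiv ^^ k) p) 0 = fact k * coeff p k"
  for p :: "complex poly"
  by (simp add: coeff_higher_pderiv pochhammer_fact[symmetric])

text \<open>
  On tuples supported in \<open>{1..s}\<close>, a functional is determined by its values on the tuples whose only
  nonzero entry is a power of \<open>x\<close>.
  Write \<open>c\<^sub>j\<close> for the value at \<open>0\<close> of the \<open>j\<close>-th derivative of an entry \<open>f i\<close>. The coefficient of
  \<open>x^(j - 1)\<close> in the first derivative of \<open>f i\<close> is \<open>c\<^sub>j / (j - 1)!\<close>, so every functional of the tuple of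
  first derivatives is a combination of the numbers \<open>c\<^sub>j\<close> with \<open>j \<ge> 1\<close>, with the coefficients \<open>a i j\<close>.
\<close>
lemma functional_as_constant_term_of_diff_op:
  assumes mu: "Vector_Spaces.linear scale_tuple (*) \<mu>"
  defines "a \<equiv> \<lambda>i j. \<mu> (single i (monom 1 (j - 1))) / fact (j - 1)"
  shows "coeff (diff_op s a f) 0 = \<mu> (restrict_tuple s (\<lambda>i. pderiv (f i)))"
proof -
  interpret mu: Vector_Spaces.linear scale_tuple "(*)" \<mu> by fact
  define N where "N = (\<Sum>i=1..s. degree (f i))"
  have N: "\<forall>i\<in>{1..s}. degree (f i) \<le> N"
    using degree_le_sum_degree[of _ s f] by (simp add: N_def)
  have expand: "\<mu> (single i p) = (\<Sum>k<n. coeff p k * \<mu> (single i (monom 1 k)))"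
    if "\<And>k. k \<ge> n \<Longrightarrow> coeff p k = 0" for i p n
  proof -
    have "p = (\<Sum>k<n. smult (coeff p k) (monom 1 k))"
      by (rule poly_eqI)
        (use that in \<open>auto simp: coeff_sum if_distrib[of "(*) _"] not_less cong: if_cong\<close>)
    moreover have "single i (\<Sum>k\<in>K. smult (c k) (monom 1 k)) =
        (\<Sum>k\<in>K. scale_tuple (c k) (single i (monom 1 k)))" for K :: "nat set" and c
      by (induction K rule: infinite_finite_induct) (simp_all add: single_hom)
    ultimately have "\<mu> (single i p) = \<mu> (\<Sum>k<n. scale_tuple (coeff p k) (single i (monom 1 k)))"
      by metis
    then show ?thesis
      by (simp add: mu.sum mu.scale)
  qed
  have "coeff (diff_op s a f) 0 =
      (\<Sum>i=1..s. \<Sum>j=1..N. a i j * (fact j * coeff (f i) j))"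
    unfolding diff_op_eq_sum[of s f, OF N] by (simp add: coeff_sum coeff_0_higher_pderiv)
  also have "\<dots> = (\<Sum>i=1..s. \<Sum>k<N. coeff (pderiv (f i)) k * \<mu> (single i (monom 1 k)))"
    unfolding One_nat_def sum.atLeast1_atMost_eq
    by (intro sum.cong refl) (simp add: a_def coeff_pderiv divide_simps)
  also have "\<dots> = (\<Sum>i=1..s. \<mu> (single i (pderiv (f i))))"
  proof (rule sum.cong[OF refl], rule expand[symmetric])
    fix i k assume "i \<in> {1..s}" "N \<le> k"
    then have "degree (f i) < Suc k"
      using N by force
    then show "coeff (pderiv (f i)) k = 0"
      by (simp add: coeff_pderiv coeff_eq_0)
  qed
  also have "\<dots> = \<mu> (restrict_tuple s (\<lambda>i. pderiv (f i)))"
    by (simp add: restrict_tuple_eq_sum mu.sum)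
  finally show ?thesis .
qed

text \<open>
  Since the operator commutes with differentiation, an identity between constant terms that
  holds for all derivatives determines all the coefficients of the image.
\<close>
lemma higher_pderiv_diff_op:
  "(pderiv ^^ k) (diff_op s a f) = diff_op s a (\<lambda>i. (pderiv ^^ k) (f i))"
proof -
  define N where "N = (\<Sum>i=1..s. degree (f i))"
  have N: "\<forall>i\<in>{1..s}. degree (f i) \<le> N"
    using degree_le_sum_degree[of _ s f] by (simp add: N_def)
  then have N': "\<forall>i\<in>{1..s}. degree ((pderiv ^^ k) (f i)) \<le> N"
    by (auto simp: degree_higher_pderiv intro: le_trans[OF diff_le_self])
  have commute: "(pderiv ^^ k) ((pderiv ^^ j) p) = (pderiv ^^ j) ((pderiv ^^ k) p)"
    for j and p :: "complex poly"
    by (metis add.commute comp_apply funpow_add)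
  show ?thesis
    unfolding diff_op_eq_sum[of s f, OF N]
      diff_op_eq_sum[of s "\<lambda>i. (pderiv ^^ k) (f i)", OF N']
    by (simp add: higher_pderiv_sum higher_pderiv_smult commute)
qed

lemma coord_higher_pderiv_x: "coord ((pderiv_x ^^ k) F) n = (pderiv ^^ k) (coord F n)"
  by (induction k) (simp_all add: coord_pderiv_x)

lemma coord_higher_pderiv: "coord ((pderiv ^^ k) F) n = coord F (n + k)"
  by (induction k arbitrary: n) (simp_all add: coord_pderiv)

section \<open>The recursion for the coordinates\<close>

theorem theorem3:
  fixes s :: nat and M :: "bipoly set"
  assumes "0 < s" and "L_module s M"
  shows "\<exists>L a.
    linear_on_tuples s L \<and>
    (\<forall>f. (\<forall>i\<in>{1..s}. finite (nonzero_terms a f i)) \<and> L f = diff_op s a f) \<and>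
    (\<forall>F\<in>M. \<forall>n\<ge>s. coord F n = L (\<lambda>i. coord F (n - s + (i - 1))))"
proof -
  have M: "poly_module M" "module.subspace scale2 M"
    using assms(2) by (auto simp: L_module_def poly_module_def)
  have closed_x: "(pderiv_x ^^ k) F \<in> M" if "F \<in> M" for F k
    using that by (induction k) (auto intro: poly_module_pderiv_x[OF M(1)])
  have closed_y: "(pderiv ^^ k) F \<in> M" if "F \<in> M" for F k
    using that by (induction k) (auto intro: poly_module_pderiv_y[OF M(1)])
  \<comment> \<open>\<open>T\<close> records the derivatives of the first \<open>s\<close> coordinates and \<open>\<nu>\<close> the constant term of the next
    one. Differentiating first is what excludes operators of order \<open>0\<close>.\<close>
  define T where "T F = restrict_tuple s (\<lambda>i. pderiv (coord F (i - 1)))" for F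
  define \<nu> where "\<nu> F = coeff (coord F s) 0" for F
  interpret scalars: vector_space "(*) :: complex \<Rightarrow> complex \<Rightarrow> complex"
    by standard (simp_all add: algebra_simps)
  have T: "Vector_Spaces.linear scale2 scale_tuple T"
    unfolding Vector_Spaces.linear_iff
    by (intro conjI allI vector_space_scale2 vector_space_scale_tuple ext)
      (simp_all add: T_def restrict_tuple_def coord_add coord_scale2 scale_tuple_def pderiv_add
        pderiv_smult)
  have nu: "Vector_Spaces.linear scale2 (*) \<nu>"
    unfolding Vector_Spaces.linear_iff
    by (intro conjI allI vector_space_scale2 scalars.vector_space_axioms)
      (simp_all add: \<nu>_def coord_add coord_scale2)
  have ker: "\<nu> F = 0" if "F \<in> M" "T F = 0" for F
  proof -
    have "pderiv (coord F n) = 0" if "n < s" for n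
      using that fun_cong[OF \<open>T F = 0\<close>, of "Suc n"] by (simp add: T_def restrict_tuple_def)
    then show ?thesis
      using L_module_next_coord_of_constants[OF assms(2) \<open>F \<in> M\<close>] by (simp add: \<nu>_def)
  qed
  obtain \<mu> where mu: "Vector_Spaces.linear scale_tuple (*) \<mu>" "\<And>F. F \<in> M \<Longrightarrow> \<mu> (T F) = \<nu> F"
    using linear_factors_through[OF T nu M(2) ker] by blast
  define a where "a = (\<lambda>i j. \<mu> (single i (monom 1 (j - 1))) / fact (j - 1))"
  have const_term: "coeff (diff_op s a (\<lambda>i. coord F (i - 1))) 0 = coeff (coord F s) 0"
    if "F \<in> M" for F
    using mu(2)[OF that] functional_as_constant_term_of_diff_op[OF mu(1), of s]
    by (simp add: a_def T_def \<nu>_def)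
  have coord_s: "coord F s = diff_op s a (\<lambda>i. coord F (i - 1))" if "F \<in> M" for F
  proof (rule poly_eqI)
    fix k
    have "coeff ((pderiv ^^ k) (coord F s)) 0 =
        coeff ((pderiv ^^ k) (diff_op s a (\<lambda>i. coord F (i - 1)))) 0"
      using const_term[OF closed_x[OF that, of k]]
      by (simp add: coord_higher_pderiv_x higher_pderiv_diff_op)
    then show "coeff (coord F s) k = coeff (diff_op s a (\<lambda>i. coord F (i - 1))) k"
      by (simp add: coeff_0_higher_pderiv)
  qed
  \<comment> \<open>Differentiating with respect to \<open>y\<close> shifts the coordinates, so the case \<open>n = s\<close> suffices.\<close>
  have coord_n: "coord F n = diff_op s a (\<lambda>i. coord F (n - s + (i - 1)))"
    if "F \<in> M" "s \<le> n" for F n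
  proof -
    have "coord F (n - s + s) = diff_op s a (\<lambda>i. coord F (n - s + (i - 1)))"
      using coord_s[OF closed_y[OF that(1), of "n - s"]]
      unfolding coord_higher_pderiv by (simp only: add.commute[of _ "n - s"])
    then show ?thesis
      unfolding le_add_diff_inverse2[OF that(2)] .
  qed
  show ?thesis
  proof (rule exI[of _ "diff_op s a"], rule exI[of _ a], intro conjI allI ballI impI)
    show "linear_on_tuples s (diff_op s a)"
      by (rule linear_on_tuples_diff_op)
    show "finite (nonzero_terms a f i)" for f i
      by (rule finite_nonzero_terms)
  qed (rule refl coord_n; assumption)+
qed

end
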